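(* Let $\sigma$ be a strictly convex smooth norm on $\mathbb{R}^n$ with unit sphere $\Sigma$. Let $\omega=H^1_-\cap H^2_-\subseteq\mathbb{R}^n$ be a minimal wedge, let $P_\omega$ be the $\sigma$-projection onto $\omega$, and let $R_\omega=I-P_\omega$. The following assertions are equivalent: 1. $P_\omega$ and $R_\omega$ are mutually polar retractions on convex cones; 2. $P_\omega$ is convex additive on $R_\omega(\mathbb{R}^n)$; 3. if $u$ is the point of the $\sigma$ray of $H^1_-$ with $\sigma(u)=1$ and $v$ is the point of the $\sigma$ray of $H^2_-$ with $\sigma(v)=1$ (hence $u,v\in\Sigma$), then the meridian arc $\gamma$ on $\Sigma$ with the endpoints $u$ and $v$ is coherent.
   Context: $\mathbb{R}^n$ carries the standard inner product $\langle\cdot,\cdot\rangle$ and Euclidean norm $\|\cdot\|$; $I$ is the identity mapping. A norm $\sigma$ is strictly convex if its unit sphere $\Sigma=\{x:\sigma(x)=1\}$ contains no line segment, and smooth if at each $x\in\Sigma$ there is exactly one supporting hyperplane of the unit ball; then $\nabla x=\nabla_\Sigma x$ denotes the Euclidean unit outward normal to $\Sigma$ at $x$. For a unit vector $a$, $H=\{x:\langle a,x\rangle=0\}$ and $H_-=\{x:\langle a,x\rangle\le0\}$. A minimal wedge is a set $\omega=H^1_-\cap H^2_-$ with $H^1\neq H^2$ hyperplanes through $0$. The $\sigma$-projection onto a closed convex cone $C$ is $P_Cx=\operatorname{argmin}\{\sigma(x-y):y\in C\}$ (the unique minimizer). The $\sigma$ray of a halfspace $H_-$ is the set $\{w\in\mathbb{R}^n:P_{H_-}w=0\}$,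 which is a ray $\{ty:t\ge0\}$, $y\neq0$. A retraction is a continuous mapping $Q:\mathbb{R}^n\to\mathbb{R}^n$ with $Q0=0$ and $Q\circ Q=Q$. $P,R$ are mutually polar retractions if both are retractions and $P+R=I$; they are mutually polar retractions on convex cones if in addition $P(\mathbb{R}^n)$ and $R(\mathbb{R}^n)$ are convex cones (nonempty sets closed under addition and under multiplication by scalars $\lambda\ge 0$). A mapping $A$ is convex additive on a set $M$ if $A(tx+(1-t)y)=tAx+(1-t)Ay$ for all $x,y\in M$, $t\in[0,1]$ (in item 2 the set is not assumed to be convex). A meridian of $\Sigma$ is a set $\Sigma\cap D$ with $D$ a two-dimensional linear subspace. The points $u,v$ here are linearly independent, and the meridian arc with endpoints $u$ and $v$ is $\gamma=\Sigma\cap\{su+tv:s,t\ge0\}$. An arc $\gamma$ on a meridian is coherent if $\dim\operatorname{span}\{\nabla_\Sigma x:x\in\gamma\}=2$. *)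

theory Defs
  imports "HOL-Analysis.Analysis"
begin

definition is_norm :: "(real ^ 'n \<Rightarrow> real) \<Rightarrow> bool" where
  "is_norm \<sigma> \<longleftrightarrow>
     (\<forall>x. 0 \<le> \<sigma> x) \<and>
     (\<forall>x. \<sigma> x = 0 \<longleftrightarrow> x = 0) \<and>
     (\<forall>c x. \<sigma> (c *\<^sub>R x) = \<bar>c\<bar> * \<sigma> x) \<and>
     (\<forall>x y. \<sigma> (x + y) \<le> \<sigma> x + \<sigma> y)"

definition norm_sphere :: "(real ^ 'n \<Rightarrow> real) \<Rightarrow> (real ^ 'n) set" where
  "norm_sphere \<sigma> = {x. \<sigma> x = 1}"

definition norm_ball :: "(real ^ 'n \<Rightarrow> real) \<Rightarrow> (real ^ 'n) set" where
  "norm_ball \<sigma> = {x. \<sigma> x \<le> 1}"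

definition strictly_convex_norm :: "(real ^ 'n \<Rightarrow> real) \<Rightarrow> bool" where
  "strictly_convex_norm \<sigma> \<longleftrightarrow>
     \<not> (\<exists>x y. x \<noteq> y \<and> closed_segment x y \<subseteq> norm_sphere \<sigma>)"

definition supporting_hyperplane ::
    "(real ^ 'n) set \<Rightarrow> real ^ 'n \<Rightarrow> (real ^ 'n) set \<Rightarrow> bool" where
  "supporting_hyperplane B x H \<longleftrightarrow>
     x \<in> H \<and> (\<exists>a b. a \<noteq> 0 \<and> H = {y. a \<bullet> y = b} \<and> B \<subseteq> {y. a \<bullet> y \<le> b})"

definition smooth_norm :: "(real ^ 'n \<Rightarrow> real) \<Rightarrow> bool" where
  "smooth_norm \<sigma> \<longleftrightarrow>
     (\<forall>x \<in> norm_sphere \<sigma>. \<exists>!H. supporting_hyperplane (norm_ball \<sigma>) x H)"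

text \<open>The Euclidean unit outward normal at \<open>x\<close>, meaningful only if \<open>\<sigma>\<close> is smooth and
  \<open>\<sigma> x = 1\<close>.  It is outward in the sense that the unit ball lies in
  \<open>{y. a \<bullet> y \<le> a \<bullet> x}\<close>.\<close>

definition outward_normal :: "(real ^ 'n \<Rightarrow> real) \<Rightarrow> real ^ 'n \<Rightarrow> real ^ 'n" where
  "outward_normal \<sigma> x = (THE a. norm a = 1 \<and> norm_ball \<sigma> \<subseteq> {y. a \<bullet> y \<le> a \<bullet> x})"

definition hyperplane0 :: "real ^ 'n \<Rightarrow> (real ^ 'n) set" where
  "hyperplane0 a = {x. a \<bullet> x = 0}"

definition halfspace0 :: "real ^ 'n \<Rightarrow> (real ^ 'n) set" where
  "halfspace0 a = {x. a \<bullet> x \<le> 0}"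

text \<open>For a strictly convex norm and a nonempty closed convex set \<open>C\<close> the minimizer exists and
  is unique, so the choice made by \<^const>\<open>arg_min_on\<close> is immaterial.\<close>

definition norm_proj ::
    "(real ^ 'n \<Rightarrow> real) \<Rightarrow> (real ^ 'n) set \<Rightarrow> real ^ 'n \<Rightarrow> real ^ 'n" where
  "norm_proj \<sigma> C x = arg_min_on (\<lambda>y. \<sigma> (x - y)) C"

definition norm_ray :: "(real ^ 'n \<Rightarrow> real) \<Rightarrow> (real ^ 'n) set \<Rightarrow> (real ^ 'n) set" where
  "norm_ray \<sigma> H = {w. norm_proj \<sigma> H w = 0}"

text \<open>Unlike \<^const>\<open>retraction\<close>, the following notion concerns self-maps of the whole space
  that fix the origin, and leaves the image implicit.\<close>

definition retraction0 :: "(real ^ 'n \<Rightarrow> real ^ 'n) \<Rightarrow> bool" where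
  "retraction0 Q \<longleftrightarrow> continuous_on UNIV Q \<and> Q 0 = 0 \<and> Q \<circ> Q = Q"

definition mutually_polar_retractions ::
    "(real ^ 'n \<Rightarrow> real ^ 'n) \<Rightarrow> (real ^ 'n \<Rightarrow> real ^ 'n) \<Rightarrow> bool" where
  "mutually_polar_retractions P R \<longleftrightarrow>
     retraction0 P \<and> retraction0 R \<and> (\<forall>x. P x + R x = x)"

definition mutually_polar_retractions_on_convex_cones ::
    "(real ^ 'n \<Rightarrow> real ^ 'n) \<Rightarrow> (real ^ 'n \<Rightarrow> real ^ 'n) \<Rightarrow> bool" where
  "mutually_polar_retractions_on_convex_cones P R \<longleftrightarrow>
     mutually_polar_retractions P R \<and> convex_cone (range P) \<and> convex_cone (range R)"

definition convex_additive_on ::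
    "(real ^ 'n) set \<Rightarrow> (real ^ 'n \<Rightarrow> real ^ 'n) \<Rightarrow> bool" where
  "convex_additive_on M A \<longleftrightarrow>
     (\<forall>x \<in> M. \<forall>y \<in> M. \<forall>t \<in> {0..1}.
        A (t *\<^sub>R x + (1 - t) *\<^sub>R y) = t *\<^sub>R A x + (1 - t) *\<^sub>R A y)"

text \<open>Intended for linearly independent \<open>u\<close>, \<open>v\<close> on the sphere; the arc then lies on the
  meridian cut out by the plane \<open>span {u, v}\<close>.\<close>

definition meridian_arc ::
    "(real ^ 'n \<Rightarrow> real) \<Rightarrow> real ^ 'n \<Rightarrow> real ^ 'n \<Rightarrow> (real ^ 'n) set" where
  "meridian_arc \<sigma> u v = norm_sphere \<sigma> \<inter> {s *\<^sub>R u + t *\<^sub>R v | s t. 0 \<le> s \<and> 0 \<le> t}"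

definition coherent_arc :: "(real ^ 'n \<Rightarrow> real) \<Rightarrow> (real ^ 'n) set \<Rightarrow> bool" where
  "coherent_arc \<sigma> \<gamma> \<longleftrightarrow> dim (span (outward_normal \<sigma> ` \<gamma>)) = 2"

end

theory Submission
  imports Defs
begin

text \<open>The kernel \<open>K = {w. P w = 0}\<close> decides everything.  For every closed convex cone the projection
\<open>P\<close> is continuous and idempotent, \<open>x - P x\<close> always projects to \<open>0\<close>, and hence the range of
\<open>R = I - P\<close> is \<open>K\<close>, which is closed under nonnegative multiples.  Therefore the first assertion
says exactly that \<open>K\<close> is convex (\<open>mutually_polar_iff_convex_kernel\<close>), and so does the second, since
\<open>P\<close> vanishes on \<open>K\<close> (\<open>convex_additive_iff_convex_kernel\<close>).

Say that \<open>a\<close> is norming at \<open>x\<close> if \<open>a\<close> is an outward normal at \<open>x\<close> to the ball of radius \<open>\<sigma> x\<close>.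
By separation, \<open>P w = 0\<close> holds for \<open>w \<noteq> 0\<close> iff some normal at \<open>w\<close> lies in the polar cone
(\<open>best_approximation_iff\<close>).  For the wedge with unit normals \<open>a\<close> and \<open>b\<close> the polar cone is the cone
spanned by \<open>a\<close> and \<open>b\<close>; the ray of each halfspace consists of \<open>0\<close> and the points with normal
\<open>a\<close>, respectively \<open>b\<close>.  So \<open>a\<close> is the normal at \<open>u\<close>, \<open>b\<close> the normal at \<open>v\<close>, both points lie
in \<open>K\<close>, and the arc is coherent iff all its normals lie in \<open>span {a, b}\<close> (\<open>coherent_arc_iff\<close>).  If \<open>K\<close> is convex, it contains
the arc, whose normals are then even in the cone spanned by \<open>a\<close> and \<open>b\<close>.

The converse is shown by proving that coherence forces \<open>K = cone {u, v}\<close>.  The key is a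
two-dimensional fact about signs (\<open>norming_pairing_signs\<close>): let \<open>k\<close> be a normal at \<open>x = s u + t v\<close>,
and let \<open>k = \<alpha> a + \<beta> b\<close> hold on the plane of \<open>u\<close> and \<open>v\<close>.  If \<open>s, t > 0\<close> then \<open>\<alpha>, \<beta> \<ge> 0\<close>, and
if \<open>\<alpha>, \<beta> > 0\<close> then \<open>s, t \<ge> 0\<close>.  The two halves are one inequality (\<open>pairing_signs\<close>) applied to a table of
pairings and to its transpose.  The first half improves the span in the definition of coherence
to the cone, so \<open>cone {u, v} \<subseteq> K\<close>.  For the other inclusion take \<open>w \<in> K\<close> with normal
\<open>k = \<alpha> a + \<beta> b\<close>.  Projecting a suitable vector of the plane of \<open>u\<close> and \<open>v\<close> onto the kernel of
\<open>k\<close> in that plane leaves a residual \<open>x\<close> in the plane with a normal proportional to \<open>k\<close> on the plane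
(\<open>ex_dual_point\<close>).  The second half puts \<open>x\<close> in the cone; by coherence its normal lies in
\<open>span {a, b}\<close>, where a vector is determined by its values on the plane, and so the normal is
proportional to \<open>k\<close>.  Strict convexity makes \<open>w\<close> a multiple of \<open>x\<close>.\<close>

section \<open>Signs in a table of pairings\<close>

text \<open>Read \<open>p\<close>, \<open>q\<close> as the pairings \<open>f v\<close>, \<open>g u\<close> of functionals and vectors of norm one with
\<open>f u = g v = 1\<close>, and consider \<open>x = s u + t v\<close> and \<open>k = \<alpha> f + \<beta> g\<close>.  The assumptions say that all
pairings of \<open>f, g, k\<close> with \<open>u, v, x\<close> are at most one in absolute value, and that \<open>k x = 1\<close>.  Exchanging
vectors and functionals exchanges \<open>(s, t, p, q)\<close> with \<open>(\<alpha>, \<beta>, q, p)\<close>, so the same statement also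
bounds \<open>s\<close> and \<open>t\<close>.\<close>

lemma pairing_signs:
  fixes p q s t \<alpha> \<beta> :: real
  assumes "\<bar>p\<bar> < 1" "\<bar>q\<bar> < 1" and s: "0 < s" and t: "0 < t"
    and fx: "\<bar>s + t * p\<bar> \<le> 1" and gx: "\<bar>s * q + t\<bar> \<le> 1"
    and ku: "\<bar>\<alpha> + \<beta> * q\<bar> \<le> 1" and kv: "\<bar>\<alpha> * p + \<beta>\<bar> \<le> 1"
    and kx: "\<alpha> * (s + t * p) + \<beta> * (s * q + t) = 1"
  shows "0 \<le> \<alpha> \<and> 0 \<le> \<beta>"
proof -
  \<comment> \<open>\<open>k - f\<close> is nonnegative at \<open>x\<close> and nonpositive at \<open>u\<close>, hence nonnegative at \<open>v\<close>, because
    \<open>x\<close> lies strictly between the two rays; similarly for \<open>k - g\<close> at \<open>u\<close>.\<close>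
  have kvp: "p \<le> \<alpha> * p + \<beta>"
  proof -
    have "s * (\<alpha> + \<beta> * q) \<le> s * 1" using ku s by (intro mult_left_mono) auto
    then have "t * p \<le> t * (\<alpha> * p + \<beta>)" using kx fx by (simp add: algebra_simps)
    then show ?thesis using t by simp
  qed
  have kuq: "q \<le> \<alpha> + \<beta> * q"
  proof -
    have "t * (\<alpha> * p + \<beta>) \<le> t * 1" using kv t by (intro mult_left_mono) auto
    then have "s * q \<le> s * (\<alpha> + \<beta> * q)" using kx gx by (simp add: algebra_simps)
    then show ?thesis using s by simp
  qed
  \<comment> \<open>Opposite signs: \<open>k v \<ge> f v\<close> forces \<open>- b < \<bar>a - 1\<bar>\<close>, while \<open>k u \<le> 1\<close> and \<open>k x = 1\<close> bound
    \<open>a - 1\<close> and \<open>1 - a\<close> by \<open>- b\<close>.\<close>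
  have mixed: False
    if "0 \<le> a" "b < 0" "\<bar>p'\<bar> < 1" "\<bar>q'\<bar> < 1" "a + b * q' \<le> 1" "p' \<le> a * p' + b"
       "a * f + b * g = 1" "f \<le> 1" "- 1 \<le> g" for a b p' q' f g :: real
  proof -
    have gap: "- b \<le> (a - 1) * p'" using that by (simp add: algebra_simps)
    have "a \<noteq> 1" using gap \<open>b < 0\<close> by auto
    then have "\<bar>a - 1\<bar> * \<bar>p'\<bar> < \<bar>a - 1\<bar> * 1"
      using that by (intro mult_strict_left_mono) auto
    moreover have "(a - 1) * p' \<le> \<bar>a - 1\<bar> * \<bar>p'\<bar>" by (metis abs_ge_self abs_mult)
    ultimately have "- b < \<bar>a - 1\<bar>" using gap by simp
    moreover have "a - 1 \<le> - b"
    proof -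
      have "b * 1 \<le> b * q'" using that by (intro mult_left_mono_neg) auto
      then show ?thesis using that(5) by linarith
    qed
    moreover have "1 - a \<le> - b"
    proof -
      have "a * f \<le> a * 1" using that by (intro mult_left_mono) auto
      moreover have "b * g \<le> b * (- 1)" using that by (intro mult_left_mono_neg) auto
      ultimately show ?thesis using that(7) by linarith
    qed
    ultimately show False by linarith
  qed
  \<comment> \<open>Both negative: then \<open>k x = 1\<close> makes \<open>f x\<close> or \<open>g x\<close> negative, say \<open>f x\<close>.  As \<open>x\<close> lies in the
    cone, \<open>g x \<ge> q' * f x\<close>, which gives \<open>k x \<le> \<bar>q'\<bar> < 1\<close>.\<close>
  have both: False
    if "a < 0" "b < 0" "\<bar>p'\<bar> < 1" "\<bar>q'\<bar> < 1" "q' \<le> a + b * q'" "p' \<le> a * p' + b"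
       "a * (s' + t' * p') + b * (s' * q' + t') = 1"
       "\<bar>s' + t' * p'\<bar> \<le> 1" "s' + t' * p' < 0" "0 < t'" for a b p' q' s' t' :: real
  proof -
    define f g where "f = s' + t' * p'" and "g = s' * q' + t'"
    have "q' * (1 - b) < 0" using that by (simp add: algebra_simps)
    then have q: "q' < 0" using that by (auto simp: mult_less_0_iff)
    have "g - q' * f = t' * (1 - p' * q')" by (simp add: f_def g_def algebra_simps)
    moreover have "p' * q' < 1"
    proof -
      have "\<bar>p'\<bar> * \<bar>q'\<bar> \<le> \<bar>p'\<bar> * 1" using that by (intro mult_left_mono) auto
      then show ?thesis using that(3) abs_ge_self[of "p' * q'"] by (simp add: abs_mult)
    qed
    then have "0 < t' * (1 - p' * q')" using that by simp
    ultimately have "q' * f \<le> g" by linarith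
    then have "b * g \<le> b * (q' * f)" using that by (intro mult_left_mono_neg) auto
    moreover have "a * f + b * g = 1" using that by (simp add: f_def g_def)
    ultimately have "1 \<le> (a + b * q') * f" by (simp add: algebra_simps)
    also have "\<dots> \<le> q' * f" using that by (intro mult_right_mono_neg) (auto simp: f_def)
    also have "\<dots> = (- q') * (- f)" by simp
    also have "\<dots> \<le> (- q') * 1" using q that by (intro mult_left_mono) (auto simp: f_def)
    finally show False using that by simp
  qed
  have notboth: False if "\<alpha> < 0" "\<beta> < 0"
  proof -
    have "s + t * p < 0 \<or> s * q + t < 0"
      using kx that mult_nonpos_nonneg[of \<alpha> "s + t * p"] mult_nonpos_nonneg[of \<beta> "s * q + t"]
      by linarith
    then show False
    proof
      assume "s + t * p < 0"
      then show False using both[of \<alpha> \<beta> p q s t] assms kvp kuq that by auto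
    next
      assume "s * q + t < 0"
      then show False using both[of \<beta> \<alpha> q p t s] assms kvp kuq that by (simp add: algebra_simps)
    qed
  qed
  have "s + t * p \<le> 1" "- 1 \<le> s + t * p" "s * q + t \<le> 1" "- 1 \<le> s * q + t"
    using fx gx by auto
  moreover have "\<alpha> + \<beta> * q \<le> 1" "\<beta> + \<alpha> * p \<le> 1" "q \<le> \<beta> * q + \<alpha>"
    "\<beta> * (s * q + t) + \<alpha> * (s + t * p) = 1"
    using ku kv kuq kx by auto
  ultimately show ?thesis
    using mixed[of \<alpha> \<beta> p q "s + t * p" "s * q + t"]
      mixed[of \<beta> \<alpha> q p "s * q + t" "s + t * p"] notboth \<open>\<bar>p\<bar> < 1\<close> \<open>\<bar>q\<bar> < 1\<close> kvp kx
    by (meson not_le)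
qed

section \<open>Norms, functionals and best approximation\<close>

locale finite_dim_norm =
  fixes \<sigma> :: "real ^ 'n \<Rightarrow> real"
  assumes is_norm: "is_norm \<sigma>"
begin

lemma nonneg [simp]: "0 \<le> \<sigma> x"
  and eq_0_iff [simp]: "\<sigma> x = 0 \<longleftrightarrow> x = 0"
  and scale: "\<sigma> (c *\<^sub>R x) = \<bar>c\<bar> * \<sigma> x"
  and triangle: "\<sigma> (x + y) \<le> \<sigma> x + \<sigma> y"
  using is_norm by (auto simp: is_norm_def)

lemma zero [simp]: "\<sigma> 0 = 0"
  by simp

lemma pos_iff [simp]: "0 < \<sigma> x \<longleftrightarrow> x \<noteq> 0"
  using nonneg[of x] eq_0_iff[of x] by linarith

lemma minus [simp]: "\<sigma> (- x) = \<sigma> x"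
  using scale[of "- 1" x] by simp

text \<open>Convexity gives continuity in finite dimension, and with it the compactness of balls.\<close>

lemma convex: "convex_on UNIV \<sigma>"
proof (rule convex_onI)
  fix t :: real and x y
  assume "0 < t" "t < 1"
  then show "\<sigma> ((1 - t) *\<^sub>R x + t *\<^sub>R y) \<le> (1 - t) * \<sigma> x + t * \<sigma> y"
    using triangle[of "(1 - t) *\<^sub>R x" "t *\<^sub>R y"] by (simp add: scale)
qed simp

lemma continuous: "continuous_on S \<sigma>"
  using convex_on_continuous[OF open_UNIV convex] continuous_on_subset by blast

lemma dominates_norm: obtains m where "0 < m" "\<And>x. m * norm x \<le> \<sigma> x"
proof -
  obtain e :: "real ^ 'n" where "norm e = 1"
    using vector_choose_size[of 1] by auto
  then obtain z where z: "norm z = 1" "\<And>y. norm y = 1 \<Longrightarrow> \<sigma> z \<le> \<sigma> y"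
    using continuous_attains_inf[OF compact_sphere _ continuous, of 0 1] by (force simp: sphere_def)
  have "\<sigma> z * norm x \<le> \<sigma> x" for x
  proof (cases "x = 0")
    case False
    then have "\<sigma> z \<le> \<sigma> ((1 / norm x) *\<^sub>R x)" by (intro z) simp
    then show ?thesis using False by (simp add: scale field_simps)
  qed simp
  moreover have "0 < \<sigma> z" using z(1) by auto
  ultimately show thesis using that by blast
qed

lemma compact_ball: "compact {y. \<sigma> (x - y) \<le> r}"
proof -
  obtain m where m: "0 < m" "\<And>x. m * norm x \<le> \<sigma> x" by (rule dominates_norm) auto
  have "{y. \<sigma> (x - y) \<le> r} \<subseteq> cball x (r / m)"
  proof
    fix y assume "y \<in> {y. \<sigma> (x - y) \<le> r}"
    then have "m * norm (x - y) \<le> r" using m(2)[of "x - y"] by simp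
    then show "y \<in> cball x (r / m)" using m(1) by (simp add: dist_norm field_simps)
  qed
  moreover have "closed {y. \<sigma> (x - y) \<le> r}"
    by (intro closed_Collect_le continuous_on_compose2[OF continuous[of UNIV]] continuous_intros) auto
  ultimately show ?thesis
    using bounded_cball bounded_subset compact_eq_bounded_closed by blast
qed

text \<open>Instead of normals to the unit sphere, normals to the ball through \<open>x\<close> are used, without
normalization; the notion is then invariant under positive scaling of \<open>a\<close> and of \<open>x\<close>, and makes
sense before smoothness is known.\<close>

definition norming :: "real ^ 'n \<Rightarrow> real ^ 'n \<Rightarrow> bool" where
  "norming a x \<longleftrightarrow> a \<noteq> 0 \<and> (\<forall>y. \<sigma> y \<le> \<sigma> x \<longrightarrow> a \<bullet> y \<le> a \<bullet> x)"

lemma normingD: "norming a x \<Longrightarrow> \<sigma> y \<le> \<sigma> x \<Longrightarrow> a \<bullet> y \<le> a \<bullet> x"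
  by (simp add: norming_def)

lemma norming_inner_pos:
  assumes "norming a x" "x \<noteq> 0"
  shows "0 < a \<bullet> x"
proof -
  define y where "y = (\<sigma> x / \<sigma> a) *\<^sub>R a"
  have "a \<noteq> 0" using assms by (simp add: norming_def)
  then have "\<sigma> y \<le> \<sigma> x" using assms by (simp add: y_def scale)
  then have "a \<bullet> y \<le> a \<bullet> x" by (rule normingD[OF assms(1)])
  moreover have "0 < a \<bullet> y" using \<open>a \<noteq> 0\<close> assms(2) by (simp add: y_def)
  ultimately show ?thesis by linarith
qed

text \<open>The homogeneous form of the definition: for \<open>x \<noteq> 0\<close>, the functional \<open>a\<close> divided by \<open>a \<bullet> x\<close> has
dual norm one over \<open>\<sigma> x\<close>.\<close>

lemma norming_bound:
  assumes "norming a x"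
  shows "(a \<bullet> y) * \<sigma> x \<le> (a \<bullet> x) * \<sigma> y"
proof (cases "y = 0")
  case False
  then have "a \<bullet> ((\<sigma> x / \<sigma> y) *\<^sub>R y) \<le> a \<bullet> x"
    by (intro normingD[OF assms]) (simp add: scale)
  then show ?thesis using False by (simp add: field_simps)
qed simp

lemma norming_abs_bound:
  assumes "norming a x" "\<sigma> x = 1" "\<sigma> y = 1"
  shows "\<bar>a \<bullet> y\<bar> \<le> a \<bullet> x"
  using norming_bound[OF assms(1), of y] norming_bound[OF assms(1), of "- y"] assms(2,3) by auto

lemma norming_scale:
  assumes "norming a x" "0 < c" "0 < d"
  shows "norming (c *\<^sub>R a) (d *\<^sub>R x)"
  unfolding norming_def
proof (intro conjI allI impI)
  fix y assume y: "\<sigma> y \<le> \<sigma> (d *\<^sub>R x)"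
  then have "\<sigma> ((1 / d) *\<^sub>R y) \<le> \<sigma> x" using assms by (simp add: scale field_simps)
  then have "a \<bullet> ((1 / d) *\<^sub>R y) \<le> a \<bullet> x" using assms(1) unfolding norming_def by blast
  then show "(c *\<^sub>R a) \<bullet> y \<le> (c *\<^sub>R a) \<bullet> (d *\<^sub>R x)" using assms by (simp add: field_simps)
qed (use assms in \<open>auto simp: norming_def\<close>)

lemma norming_scale_left_iff: "0 < c \<Longrightarrow> norming (c *\<^sub>R a) x \<longleftrightarrow> norming a x"
  using norming_scale[of a x c 1] norming_scale[of "c *\<^sub>R a" x "1 / c" 1] by auto

lemma norming_scale_right_iff: "0 < d \<Longrightarrow> norming a (d *\<^sub>R x) \<longleftrightarrow> norming a x"
  using norming_scale[of a x 1 d] norming_scale[of a "d *\<^sub>R x" 1 "1 / d"] by auto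

lemma norming_minus: "norming a x \<Longrightarrow> norming (- a) (- x)"
  unfolding norming_def by (metis inner_minus_left inner_minus_right minus minus_minus neg_equal_0_iff_equal)

lemma ex_norming_point:
  assumes "a \<noteq> 0"
  obtains x where "\<sigma> x = 1" "norming a x"
proof -
  have "compact {y. \<sigma> y \<le> 1}" using compact_ball[of 0 1] by simp
  moreover have "{y. \<sigma> y \<le> 1} \<noteq> {}" using zero zero_le_one by (metis empty_Collect_eq)
  moreover have "continuous_on {y. \<sigma> y \<le> 1} (\<lambda>y. a \<bullet> y)" by (intro continuous_intros)
  ultimately obtain x where x: "\<sigma> x \<le> 1" "\<And>y. \<sigma> y \<le> 1 \<Longrightarrow> a \<bullet> y \<le> a \<bullet> x"
    using continuous_attains_sup[of "{y. \<sigma> y \<le> 1}" "\<lambda>y. a \<bullet> y"] by blast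
  have "0 < a \<bullet> ((1 / \<sigma> a) *\<^sub>R a)" using assms by simp
  also have "\<dots> \<le> a \<bullet> x" using assms by (intro x(2)) (simp add: scale)
  finally have "0 < a \<bullet> x" .
  then have "x \<noteq> 0" by auto
  have "(a \<bullet> x) / \<sigma> x \<le> a \<bullet> x" using x(2)[of "(1 / \<sigma> x) *\<^sub>R x"] \<open>x \<noteq> 0\<close> by (simp add: scale)
  then have "(a \<bullet> x) * 1 \<le> (a \<bullet> x) * \<sigma> x" using \<open>x \<noteq> 0\<close> by (simp add: field_simps)
  then have "\<sigma> x = 1" using \<open>0 < a \<bullet> x\<close> x(1) by (simp only: mult_le_cancel_left_pos)
  then show thesis using that x(2) assms by (auto simp: norming_def)
qed

text \<open>The optimality condition for \<open>0\<close> to be nearest to \<open>x\<close> in \<open>C\<close>: the open ball of radius \<open>\<sigma> x\<close> and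
\<open>x - C\<close> are disjoint convex sets, and a hyperplane separating them passes through \<open>x\<close>, which lies in
the second set and in the closure of the first.\<close>

lemma best_approximation_iff:
  assumes "convex C" "0 \<in> C" "x \<noteq> 0"
  shows "(\<forall>c\<in>C. \<sigma> x \<le> \<sigma> (x - c)) \<longleftrightarrow> (\<exists>a. norming a x \<and> (\<forall>c\<in>C. a \<bullet> c \<le> 0))"
proof
  assume best: "\<forall>c\<in>C. \<sigma> x \<le> \<sigma> (x - c)"
  define B where "B = {y. \<sigma> y < \<sigma> x}"
  define T where "T = (\<lambda>c. x - c) ` C"
  have "convex B"
  proof (rule convexI)
    fix y z and p q :: real
    assume yz: "y \<in> B" "z \<in> B" and pq: "0 \<le> p" "0 \<le> q" "p + q = 1"
    have "\<sigma> (p *\<^sub>R y + q *\<^sub>R z) \<le> p * \<sigma> y + q * \<sigma> z"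
      using triangle[of "p *\<^sub>R y" "q *\<^sub>R z"] pq by (simp add: scale)
    also have "\<dots> < \<sigma> x"
      using yz pq by (intro convex_bound_lt) (auto simp: B_def)
    finally show "p *\<^sub>R y + q *\<^sub>R z \<in> B" by (simp add: B_def)
  qed
  moreover have "convex T"
    using convex_translation[OF convex_negations[OF assms(1)], of x]
    by (simp add: T_def image_image)
  moreover have "B \<noteq> {}" "T \<noteq> {}"
    using assms by (auto simp: B_def T_def intro: exI[of _ 0])
  moreover have "B \<inter> T = {}"
    using best by (force simp: B_def T_def)
  ultimately obtain a b where "a \<noteq> 0" "\<forall>y\<in>B. a \<bullet> y \<le> b" "\<forall>y\<in>T. b \<le> a \<bullet> y"
    using separating_hyperplane_sets by metis
  then have ab: "a \<noteq> 0" "\<And>y. \<sigma> y < \<sigma> x \<Longrightarrow> a \<bullet> y \<le> b"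
    "\<And>c. c \<in> C \<Longrightarrow> b \<le> a \<bullet> (x - c)"
    by (auto simp: B_def T_def)
  \<comment> \<open>The separation concerns the open ball; shrinking towards \<open>0\<close> carries it to the closed one.\<close>
  have closed_ball: "a \<bullet> y \<le> b" if "\<sigma> y \<le> \<sigma> x" for y
  proof -
    have "a \<bullet> ((1 - 1 / Suc n) *\<^sub>R y) \<le> b" for n
    proof (rule ab(2))
      have "\<sigma> ((1 - 1 / Suc n) *\<^sub>R y) = (1 - 1 / Suc n) * \<sigma> y"
        by (simp add: scale field_simps)
      also have "\<dots> \<le> (1 - 1 / Suc n) * \<sigma> x"
        using that by (intro mult_left_mono) (auto simp: field_simps)
      also have "\<dots> < 1 * \<sigma> x"
        using assms(3) by (intro mult_strict_right_mono) auto
      finally show "\<sigma> ((1 - 1 / Suc n) *\<^sub>R y) < \<sigma> x" by simp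
    qed
    moreover have "(\<lambda>n. a \<bullet> ((1 - 1 / Suc n) *\<^sub>R y)) \<longlonglongrightarrow> a \<bullet> ((1 - 0) *\<^sub>R y)"
      by (intro tendsto_intros LIMSEQ_Suc[OF lim_1_over_n])
    ultimately show ?thesis using LIMSEQ_le_const2 by fastforce
  qed
  have "b = a \<bullet> x" using closed_ball[of x] ab(3)[OF assms(2)] by simp
  then have "norming a x \<and> (\<forall>c\<in>C. a \<bullet> c \<le> 0)"
    using ab(1,3) closed_ball by (force simp: norming_def inner_diff_right)
  then show "\<exists>a. norming a x \<and> (\<forall>c\<in>C. a \<bullet> c \<le> 0)" by blast
next
  assume "\<exists>a. norming a x \<and> (\<forall>c\<in>C. a \<bullet> c \<le> 0)"
  then obtain a where a: "norming a x" "\<And>c. c \<in> C \<Longrightarrow> a \<bullet> c \<le> 0" by blast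
  show "\<forall>c\<in>C. \<sigma> x \<le> \<sigma> (x - c)"
  proof
    fix c assume "c \<in> C"
    then have "(a \<bullet> x) * \<sigma> x \<le> (a \<bullet> (x - c)) * \<sigma> x"
      using a(2) by (intro mult_right_mono) (auto simp: inner_diff_right)
    also have "\<dots> \<le> (a \<bullet> x) * \<sigma> (x - c)" by (rule norming_bound[OF a(1)])
    finally show "\<sigma> x \<le> \<sigma> (x - c)" using norming_inner_pos[OF a(1) assms(3)] by simp
  qed
qed

lemma ex_norming:
  assumes "x \<noteq> 0"
  obtains a where "norming a x"
  using best_approximation_iff[of "{0}" x] assms by auto

lemma ex_best_approximation:
  assumes "closed C" "C \<noteq> {}"
  obtains y where "y \<in> C" "\<And>c. c \<in> C \<Longrightarrow> \<sigma> (x - y) \<le> \<sigma> (x - c)"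
proof -
  obtain c0 where c0: "c0 \<in> C" using assms(2) by blast
  define S where "S = {y. \<sigma> (x - y) \<le> \<sigma> (x - c0)} \<inter> C"
  have "compact S" "c0 \<in> S"
    using compact_ball assms(1) c0 by (auto simp: S_def compact_Int_closed)
  moreover have "continuous_on S (\<lambda>y. \<sigma> (x - y))"
    by (intro continuous_on_compose2[OF continuous[of UNIV]] continuous_intros) auto
  ultimately obtain y where y: "y \<in> S" "\<And>c. c \<in> S \<Longrightarrow> \<sigma> (x - y) \<le> \<sigma> (x - c)"
    using continuous_attains_inf[of S "\<lambda>y. \<sigma> (x - y)"] by blast
  show thesis
  proof (rule that)
    show "y \<in> C" using y(1) by (simp add: S_def)
    fix c assume "c \<in> C"
    then show "\<sigma> (x - y) \<le> \<sigma> (x - c)"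
      using y(1) y(2)[of c] by (cases "c \<in> S") (auto simp: S_def)
  qed
qed

end

section \<open>Projections onto closed convex cones under strict convexity\<close>

locale strictly_convex_norm_space = finite_dim_norm +
  assumes strictly_convex: "strictly_convex_norm \<sigma>"
begin

text \<open>Two points of the sphere with a common normal span a segment on which the normal is constant;
it must stay in the sphere.\<close>

lemma norming_point_unique:
  assumes "norming a x" "norming a y" "\<sigma> x = 1" "\<sigma> y = 1"
  shows "x = y"
proof (rule ccontr)
  assume "x \<noteq> y"
  have "closed_segment x y \<subseteq> norm_sphere \<sigma>"
  proof
    fix z assume "z \<in> closed_segment x y"
    then obtain t where t: "z = (1 - t) *\<^sub>R x + t *\<^sub>R y" "0 \<le> t" "t \<le> 1"
      by (auto simp: in_segment)
    have "a \<bullet> x = a \<bullet> y"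
      using assms by (intro antisym normingD) auto
    then have "a \<bullet> z = a \<bullet> x" by (simp add: t inner_add_right algebra_simps)
    then have "1 \<le> \<sigma> z"
      using norming_bound[OF assms(1), of z] norming_inner_pos[OF assms(1)] assms(3) by force
    moreover have "\<sigma> z \<le> (1 - t) * \<sigma> x + t * \<sigma> y"
      using triangle[of "(1 - t) *\<^sub>R x" "t *\<^sub>R y"] t by (simp add: scale)
    ultimately show "z \<in> norm_sphere \<sigma>" using assms by (simp add: norm_sphere_def)
  qed
  then show False using strictly_convex \<open>x \<noteq> y\<close> by (auto simp: strictly_convex_norm_def)
qed

text \<open>After translating the first minimizer to \<open>0\<close>, a normal from the optimality condition is a normal at both
residuals, so these coincide.\<close>

lemma best_approximation_unique:
  assumes "convex C" "y \<in> C" "z \<in> C"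
    and y: "\<And>c. c \<in> C \<Longrightarrow> \<sigma> (x - y) \<le> \<sigma> (x - c)"
    and z: "\<And>c. c \<in> C \<Longrightarrow> \<sigma> (x - z) \<le> \<sigma> (x - c)"
  shows "y = z"
proof (cases "x = y")
  case True
  then show ?thesis using z[OF assms(2)] eq_0_iff[of "x - z"] nonneg[of "x - z"] by force
next
  case False
  define r where "r = \<sigma> (x - y)"
  have r: "0 < r" "\<sigma> (x - z) = r" using False y[OF assms(3)] z[OF assms(2)] by (auto simp: r_def)
  define C' where "C' = (\<lambda>c. c - y) ` C"
  have "convex C'" "0 \<in> C'"
    using assms(1,2) by (auto simp: C'_def convex_translation_subtract_eq)
  moreover have "\<forall>c\<in>C'. \<sigma> (x - y) \<le> \<sigma> (x - y - c)"
    using y by (auto simp: C'_def)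
  ultimately obtain a where a: "norming a (x - y)" "\<forall>c\<in>C'. a \<bullet> c \<le> 0"
    using best_approximation_iff[of C' "x - y"] False by auto
  have "a \<bullet> (x - y) \<le> a \<bullet> (x - z)"
    using a(2) assms(3) by (auto simp: C'_def inner_diff_right)
  then have "norming a (x - z)"
    using a(1) r unfolding norming_def r_def by force
  then have "norming a ((1 / r) *\<^sub>R (x - y))" "norming a ((1 / r) *\<^sub>R (x - z))"
    using a(1) r by (simp_all only: norming_scale_right_iff zero_less_divide_1_iff)
  then have "(1 / r) *\<^sub>R (x - y) = (1 / r) *\<^sub>R (x - z)"
    using r by (intro norming_point_unique) (auto simp: scale r_def)
  then show ?thesis using r by simp
qed

lemma norm_proj:
  assumes "closed C" "convex C" "C \<noteq> {}"
  shows norm_proj_in: "norm_proj \<sigma> C x \<in> C"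
    and norm_proj_le: "c \<in> C \<Longrightarrow> \<sigma> (x - norm_proj \<sigma> C x) \<le> \<sigma> (x - c)"
proof -
  obtain y where y: "y \<in> C" "\<And>c. c \<in> C \<Longrightarrow> \<sigma> (x - y) \<le> \<sigma> (x - c)"
    using ex_best_approximation assms by blast
  then have "is_arg_min (\<lambda>y. \<sigma> (x - y)) (\<lambda>y. y \<in> C) y"
    by (auto simp: is_arg_min_linorder)
  then have "is_arg_min (\<lambda>y. \<sigma> (x - y)) (\<lambda>y. y \<in> C) (norm_proj \<sigma> C x)"
    unfolding norm_proj_def arg_min_on_def arg_min_def by (rule someI)
  then show "norm_proj \<sigma> C x \<in> C" "c \<in> C \<Longrightarrow> \<sigma> (x - norm_proj \<sigma> C x) \<le> \<sigma> (x - c)"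
    by (auto simp: is_arg_min_linorder)
qed

lemma norm_proj_eq_iff:
  assumes "closed C" "convex C" "C \<noteq> {}"
  shows "norm_proj \<sigma> C x = y \<longleftrightarrow> y \<in> C \<and> (\<forall>c\<in>C. \<sigma> (x - y) \<le> \<sigma> (x - c))"
  using norm_proj_in[OF assms] norm_proj_le[OF assms] best_approximation_unique[OF assms(2)] by metis

text \<open>The minimality conditions are closed, so the graph of the projection over a closed ball is
closed; the values stay in a compact set, because the distance from \<open>x\<close> to \<open>C\<close> is at most that to a
fixed point of \<open>C\<close>.\<close>

lemma continuous_norm_proj:
  assumes "closed C" "convex C" "C \<noteq> {}"
  shows "continuous_on S (norm_proj \<sigma> C)"
proof -
  obtain m where m: "0 < m" "\<And>x. m * norm x \<le> \<sigma> x" by (rule dominates_norm) auto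
  obtain c0 where c0: "c0 \<in> C" using assms(3) by blast
  have "continuous (at x) (norm_proj \<sigma> C)" for x
  proof -
    have "bounded (\<sigma> ` ((\<lambda>z. z - c0) ` cball x 1))" "bounded (cball x 1)"
      by (intro compact_imp_bounded compact_continuous_image continuous continuous_intros
          compact_cball bounded_cball)+
    then obtain b b' where b: "\<And>z. z \<in> cball x 1 \<Longrightarrow> \<sigma> (z - c0) \<le> b" "\<And>z. z \<in> cball x 1 \<Longrightarrow> norm z \<le> b'"
      unfolding bounded_iff by force
    define T where "T = cball 0 (b' + b / m) \<inter> C"
    have "norm_proj \<sigma> C z \<in> T" if "z \<in> cball x 1" for z
    proof -
      have "m * norm (z - norm_proj \<sigma> C z) \<le> b"
        using m(2) norm_proj_le[OF assms c0, of z] b(1)[OF that] by (meson order_trans)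
      then have "norm (z - norm_proj \<sigma> C z) \<le> b / m" using m(1) by (simp add: field_simps)
      then have "norm (norm_proj \<sigma> C z) \<le> b' + b / m"
        using b(2)[OF that] norm_triangle_sub[of "norm_proj \<sigma> C z" z]
          norm_minus_commute[of z "norm_proj \<sigma> C z"]
        by linarith
      then show ?thesis using norm_proj_in[OF assms] by (simp add: T_def)
    qed
    moreover have "compact T" using assms(1) by (simp add: T_def compact_Int_closed)
    moreover have "closed ((\<lambda>z. (z, norm_proj \<sigma> C z)) ` cball x 1)"
    proof -
      have "(\<lambda>z. (z, norm_proj \<sigma> C z)) ` cball x 1 =
          {w. fst w \<in> cball x 1 \<and> norm_proj \<sigma> C (fst w) = snd w}"
        by force
      also have "\<dots> = (cball x 1 \<times> C) \<inter> (\<Inter>c\<in>C. {w. \<sigma> (fst w - snd w) \<le> \<sigma> (fst w - c)})"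
        unfolding norm_proj_eq_iff[OF assms] by auto
      finally have "(\<lambda>z. (z, norm_proj \<sigma> C z)) ` cball x 1 = \<dots>" .
      moreover have "closed {w. \<sigma> (fst w - snd w) \<le> \<sigma> (fst w - c)}" for c
        by (intro closed_Collect_le continuous_on_compose2[OF continuous[of UNIV]] continuous_intros) auto
      ultimately show ?thesis
        using assms(1) by (auto intro!: closed_Int closed_INT closed_Times)
    qed
    ultimately have "continuous_on (cball x 1) (norm_proj \<sigma> C)"
      by (intro continuous_from_closed_graph[of T]) auto
    then have "continuous_on (ball x 1) (norm_proj \<sigma> C)"
      by (rule continuous_on_subset) (rule ball_subset_cball)
    then show ?thesis
      by (simp add: continuous_on_eq_continuous_at)
  qed
  then show ?thesis
    by (simp add: continuous_at_imp_continuous_on)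
qed

text \<open>For a cone, \<open>P x + c\<close> is again a competitor in the minimization for \<open>x\<close>, so \<open>0\<close> is nearest to
\<open>x - P x\<close>.\<close>

lemma residual_range:
  assumes "closed C" "convex_cone C"
  shows "range (\<lambda>x. x - norm_proj \<sigma> C x) = {w. norm_proj \<sigma> C w = 0}"
proof -
  have C: "closed C" "convex C" "C \<noteq> {}" using assms by (auto simp: convex_cone_def)
  have cone: "0 \<in> C" "\<And>x y. x \<in> C \<Longrightarrow> y \<in> C \<Longrightarrow> x + y \<in> C"
    using assms(2) by (auto simp: convex_cone_iff)
  have "norm_proj \<sigma> C (x - norm_proj \<sigma> C x) = 0" for x
    using norm_proj_le[OF C] norm_proj_in[OF C] cone
    by (subst norm_proj_eq_iff[OF C]) (auto simp: diff_diff_eq)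
  moreover have "w = w - norm_proj \<sigma> C w" if "norm_proj \<sigma> C w = 0" for w
    using that by simp
  ultimately show ?thesis by blast
qed

lemma residual_range_conic:
  assumes "closed C" "convex_cone C" "norm_proj \<sigma> C w = 0" "0 \<le> r"
  shows "norm_proj \<sigma> C (r *\<^sub>R w) = 0"
proof -
  have C: "closed C" "convex C" "C \<noteq> {}" "0 \<in> C" and cone: "\<And>x k. x \<in> C \<Longrightarrow> 0 \<le> k \<Longrightarrow> k *\<^sub>R x \<in> C"
    using assms convex_cone_iff[of C] by (auto simp: convex_cone_def)
  have "\<sigma> (r *\<^sub>R w) \<le> \<sigma> (r *\<^sub>R w - c)" if "c \<in> C" for c
  proof (cases "r = 0")
    case False
    then have "\<sigma> w \<le> \<sigma> (w - (1 / r) *\<^sub>R c)"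
      using norm_proj_le[OF C(1-3), of "(1 / r) *\<^sub>R c" w] cone[OF that] assms(3,4) by simp
    then have "r * \<sigma> w \<le> r * \<sigma> (w - (1 / r) *\<^sub>R c)"
      using assms(4) by (rule mult_left_mono)
    moreover have "r *\<^sub>R w - c = r *\<^sub>R (w - (1 / r) *\<^sub>R c)"
      using False by (simp add: scaleR_diff_right)
    ultimately show ?thesis using assms(4) by (simp add: scale)
  qed (use scale in auto)
  then show ?thesis using C by (subst norm_proj_eq_iff) auto
qed

text \<open>All requirements except the convexity of the range of \<open>I - P\<close> hold for every closed convex cone.\<close>

lemma mutually_polar_iff_convex_kernel:
  assumes "closed C" "convex_cone C"
  shows "mutually_polar_retractions_on_convex_cones (norm_proj \<sigma> C) (\<lambda>x. x - norm_proj \<sigma> C x) \<longleftrightarrow>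
    convex {w. norm_proj \<sigma> C w = 0}"
proof -
  have C: "closed C" "convex C" "C \<noteq> {}" "0 \<in> C"
    using assms convex_cone_iff[of C] by (auto simp: convex_cone_def)
  have fix_C: "norm_proj \<sigma> C y = y" if "y \<in> C" for y
    using that by (subst norm_proj_eq_iff[OF C(1-3)]) auto
  then have range: "range (norm_proj \<sigma> C) = C"
    using norm_proj_in[OF C(1-3)] by (metis UNIV_I image_eqI image_subsetI subsetI subset_antisym)
  have "norm_proj \<sigma> C (x - norm_proj \<sigma> C x) = 0" for x
    using residual_range[OF assms] by blast
  then have "mutually_polar_retractions (norm_proj \<sigma> C) (\<lambda>x. x - norm_proj \<sigma> C x)"
    using fix_C C(4) norm_proj_in[OF C(1-3)] continuous_norm_proj[OF C(1-3)]
    by (auto simp: mutually_polar_retractions_def retraction0_def fun_eq_iff intro!: continuous_intros)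
  moreover have "conic {w. norm_proj \<sigma> C w = 0}"
    using residual_range_conic[OF assms] by (auto simp: conic_def)
  moreover have "0 \<in> {w. norm_proj \<sigma> C w = 0}" using fix_C C(4) by simp
  ultimately show ?thesis
    using assms(2)
    unfolding mutually_polar_retractions_on_convex_cones_def residual_range[OF assms] range convex_cone_def
    by blast
qed

lemma convex_additive_iff_convex_kernel:
  "convex_additive_on {w. norm_proj \<sigma> C w = 0} (norm_proj \<sigma> C) \<longleftrightarrow>
    convex {w. norm_proj \<sigma> C w = 0}"
proof -
  have "convex M \<longleftrightarrow> (\<forall>x\<in>M. \<forall>y\<in>M. \<forall>t\<in>{0..1}. t *\<^sub>R x + (1 - t) *\<^sub>R y \<in> M)"
    for M :: "(real ^ 'n) set"
    unfolding convex_alt by (metis add.commute atLeastAtMost_iff)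
  then show ?thesis by (auto simp: convex_additive_on_def)
qed

end

locale strictly_convex_smooth_norm_space = strictly_convex_norm_space +
  assumes smooth: "smooth_norm \<sigma>"
begin

text \<open>By smoothness the two normals cut out the same supporting hyperplane through \<open>x\<close>; both are positive
at \<open>x\<close>, so the hyperplane determines them up to a factor.\<close>

lemma norming_unique_direction:
  assumes a: "norming a x" and b: "norming b x" and "\<sigma> x = 1"
  shows "b = ((b \<bullet> x) / (a \<bullet> x)) *\<^sub>R a"
proof -
  have "x \<noteq> 0" using \<open>\<sigma> x = 1\<close> by auto
  have supp: "supporting_hyperplane (norm_ball \<sigma>) x {y. a \<bullet> y = a \<bullet> x}"
    if "norming a x" for a
    using that \<open>\<sigma> x = 1\<close> unfolding supporting_hyperplane_def norming_def norm_ball_def by auto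
  have eq: "{y. a \<bullet> y = a \<bullet> x} = {y. b \<bullet> y = b \<bullet> x}"
    using smooth supp[OF a] supp[OF b] \<open>\<sigma> x = 1\<close> unfolding smooth_norm_def norm_sphere_def by blast
  have ax: "0 < a \<bullet> x" using norming_inner_pos[OF a \<open>x \<noteq> 0\<close>] .
  have "b \<bullet> y = (((b \<bullet> x) / (a \<bullet> x)) *\<^sub>R a) \<bullet> y" for y
  proof -
    have "a \<bullet> (x + y - ((a \<bullet> y) / (a \<bullet> x)) *\<^sub>R x) = a \<bullet> x"
      using ax by (simp add: inner_add_right inner_diff_right)
    then have "b \<bullet> (x + y - ((a \<bullet> y) / (a \<bullet> x)) *\<^sub>R x) = b \<bullet> x"
      using eq by blast
    then show ?thesis by (simp add: inner_add_right inner_diff_right field_simps)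
  qed
  then show ?thesis by (metis vector_eq_rdot)
qed

lemma outward_normal_eq:
  assumes "norming a x" "\<sigma> x = 1"
  shows "outward_normal \<sigma> x = (1 / norm a) *\<^sub>R a"
  unfolding outward_normal_def
proof (rule the_equality)
  have "a \<noteq> 0" using assms(1) by (simp add: norming_def)
  then show "norm ((1 / norm a) *\<^sub>R a) = 1 \<and>
      norm_ball \<sigma> \<subseteq> {y. ((1 / norm a) *\<^sub>R a) \<bullet> y \<le> ((1 / norm a) *\<^sub>R a) \<bullet> x}"
    using assms by (auto simp: norming_def norm_ball_def divide_right_mono)
  fix b assume b: "norm b = 1 \<and> norm_ball \<sigma> \<subseteq> {y. b \<bullet> y \<le> b \<bullet> x}"
  then have "norming b x" using assms(2) by (auto simp: norming_def norm_ball_def)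
  moreover have "x \<noteq> 0" using assms(2) by auto
  ultimately have "0 < (b \<bullet> x) / (a \<bullet> x)" "b = ((b \<bullet> x) / (a \<bullet> x)) *\<^sub>R a"
    using norming_inner_pos norming_unique_direction assms by auto
  then obtain c where c: "0 < c" "b = c *\<^sub>R a" by blast
  then have "c * norm a = 1" using b by simp
  then show "b = (1 / norm a) *\<^sub>R a" using c \<open>a \<noteq> 0\<close> by (simp add: field_simps)
qed

end

section \<open>Polars of halfspaces and wedges\<close>

lemma unit_inner_less_one:
  fixes a b :: "'a :: real_inner"
  assumes "norm a = 1" "norm b = 1" "a \<noteq> b" "a \<noteq> - b"
  shows "\<bar>a \<bullet> b\<bar> < 1"
proof -
  have "a \<bullet> a = 1" "b \<bullet> b = 1" using assms by (auto simp: dot_square_norm)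
  moreover have "0 < (a - b) \<bullet> (a - b)" "0 < (a + b) \<bullet> (a + b)"
    using assms by (auto simp: add_eq_0_iff2)
  ultimately show ?thesis
    by (auto simp: inner_diff_left inner_diff_right inner_add_left inner_add_right inner_commute)
qed

text \<open>The part of \<open>k\<close> orthogonal to \<open>a\<close> belongs to the halfspace, so it pairs nonpositively with \<open>k\<close>
and vanishes.  The wedge is treated in the same way.\<close>

lemma polar_halfspace:
  fixes a k :: "real ^ 'n"
  assumes "norm a = 1"
  shows "(\<forall>c\<in>halfspace0 a. k \<bullet> c \<le> 0) \<longleftrightarrow> (\<exists>s\<ge>0. k = s *\<^sub>R a)"
proof
  assume k: "\<forall>c\<in>halfspace0 a. k \<bullet> c \<le> 0"
  have aa: "a \<bullet> a = 1" using assms by (simp add: dot_square_norm)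
  define r where "r = k - (k \<bullet> a) *\<^sub>R a"
  have ar: "a \<bullet> r = 0" using aa by (simp add: r_def inner_diff_right inner_commute)
  then have "k \<bullet> r \<le> 0" using k by (simp add: halfspace0_def)
  moreover have "k \<bullet> r = r \<bullet> r"
    using ar by (simp add: r_def inner_diff_left inner_diff_right inner_commute)
  ultimately have "r = 0" by (metis inner_eq_zero_iff inner_ge_zero order_antisym)
  moreover have "- a \<in> halfspace0 a" using aa by (simp add: halfspace0_def)
  then have "0 \<le> k \<bullet> a" using k by fastforce
  ultimately show "\<exists>s\<ge>0. k = s *\<^sub>R a" by (auto simp: r_def)
qed (auto simp: halfspace0_def mult_nonneg_nonpos)

lemma polar_wedge:
  fixes a b k :: "real ^ 'n"
  assumes "norm a = 1" "norm b = 1" "a \<noteq> b" "a \<noteq> - b"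
  shows "(\<forall>c\<in>halfspace0 a \<inter> halfspace0 b. k \<bullet> c \<le> 0) \<longleftrightarrow>
    (\<exists>s\<ge>0. \<exists>t\<ge>0. k = s *\<^sub>R a + t *\<^sub>R b)"
proof
  assume k: "\<forall>c\<in>halfspace0 a \<inter> halfspace0 b. k \<bullet> c \<le> 0"
  define g where "g = a \<bullet> b"
  define d where "d = 1 - g * g"
  have aa: "a \<bullet> a = 1" "b \<bullet> b = 1" "a \<bullet> b = g" "b \<bullet> a = g"
    using assms by (auto simp: dot_square_norm g_def inner_commute)
  have "0 < d"
    using unit_inner_less_one[OF assms] by (simp add: d_def g_def abs_square_less_1 flip: power2_eq_square)
  \<comment> \<open>The coefficients of the orthogonal projection of \<open>k\<close> to \<open>span {a, b}\<close>, from its Gram matrix.\<close>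
  define s t where "s = (k \<bullet> a - g * (k \<bullet> b)) / d" and "t = (k \<bullet> b - g * (k \<bullet> a)) / d"
  define r where "r = k - s *\<^sub>R a - t *\<^sub>R b"
  have "a \<bullet> k - s - t * g = 0" "b \<bullet> k - s * g - t = 0"
    using \<open>0 < d\<close> by (simp_all add: s_def t_def inner_commute field_simps) (simp_all add: d_def algebra_simps)
  then have ar: "a \<bullet> r = 0" "b \<bullet> r = 0"
    using aa by (simp_all add: r_def inner_diff_right)
  then have "k \<bullet> r \<le> 0" using k by (simp add: halfspace0_def)
  moreover have "k \<bullet> r = r \<bullet> r"
    using ar by (simp add: r_def[of] inner_diff_left)
  ultimately have "r = 0" by (metis inner_eq_zero_iff inner_ge_zero order_antisym)
  \<comment> \<open>Up to scaling, the generators of the wedge within \<open>span {a, b}\<close>: each lies on one of the two hyperplanes.\<close>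
  moreover have "g *\<^sub>R b - a \<in> halfspace0 a \<inter> halfspace0 b" "g *\<^sub>R a - b \<in> halfspace0 a \<inter> halfspace0 b"
    using \<open>0 < d\<close> aa by (auto simp: halfspace0_def inner_diff_right d_def)
  then have "k \<bullet> (g *\<^sub>R b - a) \<le> 0" "k \<bullet> (g *\<^sub>R a - b) \<le> 0" using k by blast+
  then have "0 \<le> s" "0 \<le> t"
    using \<open>0 < d\<close> by (simp_all add: s_def t_def inner_diff_right)
  ultimately show "\<exists>s\<ge>0. \<exists>t\<ge>0. k = s *\<^sub>R a + t *\<^sub>R b" by (auto simp: r_def algebra_simps)
qed (auto simp: halfspace0_def inner_add_left intro!: add_nonpos_nonpos mult_nonneg_nonpos)

lemma closed_convex_cone_halfspace0:
  "closed (halfspace0 a)" "convex_cone (halfspace0 a)"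
  by (auto simp: halfspace0_def closed_halfspace_le convex_cone_iff inner_add_right
      intro: add_nonpos_nonpos mult_nonneg_nonpos)

lemma closed_convex_cone_wedge:
  "closed (halfspace0 a \<inter> halfspace0 b)" "convex_cone (halfspace0 a \<inter> halfspace0 b)"
  using closed_convex_cone_halfspace0[of a] closed_convex_cone_halfspace0[of b]
  by (auto simp: convex_cone_iff)

section \<open>Normals over a plane\<close>

context finite_dim_norm
begin

text \<open>The two applications of \<open>pairing_signs\<close>.  The identity \<open>k = \<alpha> a + \<beta> b\<close> is demanded
on the plane of \<open>u\<close> and \<open>v\<close> only, since \<open>ex_dual_point\<close> provides no more.\<close>

lemma norming_pairing_signs:
  assumes a: "norming a u" and b: "norming b v" and k: "norming k x"
    and unit: "\<sigma> u = 1" "\<sigma> v = 1" "\<sigma> x = 1"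
    and av: "\<bar>a \<bullet> v\<bar> < a \<bullet> u" and bu: "\<bar>b \<bullet> u\<bar> < b \<bullet> v"
    and x: "x = s *\<^sub>R u + t *\<^sub>R v"
    and ku: "k \<bullet> u = \<alpha> * (a \<bullet> u) + \<beta> * (b \<bullet> u)"
    and kv: "k \<bullet> v = \<alpha> * (a \<bullet> v) + \<beta> * (b \<bullet> v)"
  shows "0 < s \<Longrightarrow> 0 < t \<Longrightarrow> 0 \<le> \<alpha> \<and> 0 \<le> \<beta>"
    and "0 < \<alpha> \<Longrightarrow> 0 < \<beta> \<Longrightarrow> 0 \<le> s \<and> 0 \<le> t"
proof -
  have nz: "u \<noteq> 0" "v \<noteq> 0" "x \<noteq> 0" using unit by auto
  have pos: "0 < a \<bullet> u" "0 < b \<bullet> v" "0 < k \<bullet> x"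
    using norming_inner_pos a b k nz by auto
  \<comment> \<open>Rescaling the functionals so that \<open>a\<close>, \<open>b\<close>, \<open>k\<close> take the value one at \<open>u\<close>, \<open>v\<close>, \<open>x\<close>.\<close>
  define A where "A = \<alpha> * (a \<bullet> u) / (k \<bullet> x)"
  define B where "B = \<beta> * (b \<bullet> v) / (k \<bullet> x)"
  define p where "p = (a \<bullet> v) / (a \<bullet> u)"
  define q where "q = (b \<bullet> u) / (b \<bullet> v)"
  have pq: "\<bar>p\<bar> < 1" "\<bar>q\<bar> < 1" using av bu pos by (auto simp: p_def q_def abs_divide)
  have ax: "s + t * p = (a \<bullet> x) / (a \<bullet> u)" "s * q + t = (b \<bullet> x) / (b \<bullet> v)"
    using pos by (auto simp: p_def q_def x inner_add_right field_simps)
  have kA: "A + B * q = (k \<bullet> u) / (k \<bullet> x)" "A * p + B = (k \<bullet> v) / (k \<bullet> x)"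
    using pos by (auto simp: A_def B_def p_def q_def ku kv field_simps)
  have bounds: "\<bar>s + t * p\<bar> \<le> 1" "\<bar>s * q + t\<bar> \<le> 1" "\<bar>A + B * q\<bar> \<le> 1" "\<bar>A * p + B\<bar> \<le> 1"
    unfolding ax kA using pos unit norming_abs_bound a b k by (auto simp: abs_divide)
  have "k \<bullet> x = s * (k \<bullet> u) + t * (k \<bullet> v)" by (simp add: x inner_add_right)
  then have "s * (A + B * q) + t * (A * p + B) = (k \<bullet> x) / (k \<bullet> x)"
    unfolding kA by (metis add_divide_distrib times_divide_eq_right)
  then have one: "s * (A + B * q) + t * (A * p + B) = 1" using pos by simp
  then have one': "A * (s + t * p) + B * (s * q + t) = 1" by (simp add: algebra_simps)
  have signs: "0 \<le> A \<longleftrightarrow> 0 \<le> \<alpha>" "0 \<le> B \<longleftrightarrow> 0 \<le> \<beta>" "0 < A \<longleftrightarrow> 0 < \<alpha>" "0 < B \<longleftrightarrow> 0 < \<beta>"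
    using pos by (auto simp: A_def B_def zero_le_divide_iff zero_less_divide_iff zero_le_mult_iff zero_less_mult_iff)
  show "0 < s \<Longrightarrow> 0 < t \<Longrightarrow> 0 \<le> \<alpha> \<and> 0 \<le> \<beta>"
    using pairing_signs[OF pq _ _ bounds one'] signs by blast
  show "0 < \<alpha> \<Longrightarrow> 0 < \<beta> \<Longrightarrow> 0 \<le> s \<and> 0 \<le> t"
    using pairing_signs[OF pq(2,1) _ _ bounds(3,4,1,2) one] signs by blast
qed

end

context strictly_convex_norm_space
begin

lemma norm_proj_eq_0_iff:
  assumes "closed C" "convex_cone C" "x \<noteq> 0"
  shows "norm_proj \<sigma> C x = 0 \<longleftrightarrow> (\<exists>a. norming a x \<and> (\<forall>c\<in>C. a \<bullet> c \<le> 0))"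
proof -
  have C: "closed C" "convex C" "C \<noteq> {}" "0 \<in> C"
    using assms convex_cone_iff[of C] by (auto simp: convex_cone_def)
  show ?thesis
    using best_approximation_iff[OF C(2,4) assms(3)] C(4) by (simp add: norm_proj_eq_iff[OF C(1-3)])
qed

lemma norm_ray_halfspace:
  assumes "norm a = 1" "\<sigma> u = 1"
  shows "u \<in> norm_ray \<sigma> (halfspace0 a) \<longleftrightarrow> norming a u"
proof -
  have "u \<noteq> 0" using assms by auto
  then have "u \<in> norm_ray \<sigma> (halfspace0 a) \<longleftrightarrow> (\<exists>s\<ge>0. norming (s *\<^sub>R a) u)"
    using assms by (auto simp: norm_ray_def norm_proj_eq_0_iff[OF closed_convex_cone_halfspace0] polar_halfspace)
  also have "\<dots> \<longleftrightarrow> (\<exists>s>0. norming (s *\<^sub>R a) u)"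
    by (metis less_le norming_def scale_zero_left)
  also have "\<dots> \<longleftrightarrow> norming a u"
    using norming_scale_left_iff zero_less_one by blast
  finally show ?thesis .
qed

end

section \<open>The kernel of the projection onto a wedge\<close>

locale wedge_rays = strictly_convex_smooth_norm_space +
  fixes a b u v
  assumes unit: "norm a = 1" "norm b = 1" and distinct: "a \<noteq> b" "a \<noteq> - b"
    and u: "norming a u" "\<sigma> u = 1" and v: "norming b v" "\<sigma> v = 1"
begin

abbreviation "\<omega> \<equiv> halfspace0 a \<inter> halfspace0 b"
abbreviation "K \<equiv> {w. norm_proj \<sigma> \<omega> w = 0}"

lemma not_parallel: "u \<noteq> v" "u \<noteq> - v"
proof -
  have "outward_normal \<sigma> u = a" "outward_normal \<sigma> v = b" "outward_normal \<sigma> (- v) = - b"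
    using outward_normal_eq[OF u] outward_normal_eq[OF v] outward_normal_eq[OF norming_minus[OF v(1)]] v(2) unit
    by simp_all
  then show "u \<noteq> v" "u \<noteq> - v" using distinct by auto
qed

lemma cross_pairings: "\<bar>a \<bullet> v\<bar> < a \<bullet> u" "\<bar>b \<bullet> u\<bar> < b \<bullet> v"
proof -
  have *: "\<bar>c \<bullet> y\<bar> < c \<bullet> x"
    if c: "norming c x" "\<sigma> x = 1" "\<sigma> y = 1" and "x \<noteq> y" "x \<noteq> - y" for c x y
  proof -
    have "x = z" if "c \<bullet> z = c \<bullet> x" "\<sigma> z = 1" for z
      using that c by (intro norming_point_unique[of c]) (simp_all add: norming_def)
    from this[of y] this[of "- y"] have "c \<bullet> y \<noteq> c \<bullet> x" "c \<bullet> (- y) \<noteq> c \<bullet> x"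
      using c(3) minus[of y] \<open>x \<noteq> y\<close> \<open>x \<noteq> - y\<close> by metis+
    then show ?thesis using norming_abs_bound[OF c] by auto
  qed
  show "\<bar>a \<bullet> v\<bar> < a \<bullet> u" "\<bar>b \<bullet> u\<bar> < b \<bullet> v"
    using *[OF u v(2)] *[OF v u(2)] not_parallel by (metis minus_minus)+
qed

text \<open>By \<open>cross_pairings\<close> the matrix of pairings of \<open>a, b\<close> with \<open>u, v\<close> is invertible: an element of
\<open>span {a, b}\<close> is determined by its values at \<open>u\<close> and \<open>v\<close>.\<close>

lemma coefficients_determined:
  assumes "\<alpha> * (a \<bullet> u) + \<beta> * (b \<bullet> u) = 0" "\<alpha> * (a \<bullet> v) + \<beta> * (b \<bullet> v) = 0"
  shows "\<alpha> = 0 \<and> \<beta> = 0"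
proof -
  have "\<bar>a \<bullet> v\<bar> * \<bar>b \<bullet> u\<bar> < (a \<bullet> u) * (b \<bullet> v)"
    using cross_pairings by (intro mult_strict_mono') auto
  then have det: "(a \<bullet> u) * (b \<bullet> v) - (a \<bullet> v) * (b \<bullet> u) \<noteq> 0"
    using abs_ge_self[of "(a \<bullet> v) * (b \<bullet> u)"] by (simp add: abs_mult)
  have "\<alpha> * ((a \<bullet> u) * (b \<bullet> v) - (a \<bullet> v) * (b \<bullet> u)) =
      (\<alpha> * (a \<bullet> u) + \<beta> * (b \<bullet> u)) * (b \<bullet> v) - (\<alpha> * (a \<bullet> v) + \<beta> * (b \<bullet> v)) * (b \<bullet> u)"
    by (simp add: algebra_simps)
  moreover have "\<beta> * ((a \<bullet> u) * (b \<bullet> v) - (a \<bullet> v) * (b \<bullet> u)) =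
      (\<alpha> * (a \<bullet> v) + \<beta> * (b \<bullet> v)) * (a \<bullet> u) - (\<alpha> * (a \<bullet> u) + \<beta> * (b \<bullet> u)) * (a \<bullet> v)"
    by (simp add: algebra_simps)
  ultimately show ?thesis
    using det unfolding assms by (simp only: mult_eq_0_iff mult_zero_left diff_self) blast
qed

lemma kernel_iff:
  assumes "w \<noteq> 0"
  shows "w \<in> K \<longleftrightarrow> (\<exists>s\<ge>0. \<exists>t\<ge>0. norming (s *\<^sub>R a + t *\<^sub>R b) w)"
proof -
  have "w \<in> K \<longleftrightarrow> (\<exists>k. norming k w \<and> (\<exists>s\<ge>0. \<exists>t\<ge>0. k = s *\<^sub>R a + t *\<^sub>R b))"
    by (simp only: mem_Collect_eq norm_proj_eq_0_iff[OF closed_convex_cone_wedge assms]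
        polar_wedge[OF unit distinct])
  then show ?thesis by blast
qed

lemma rays_in_kernel: "u \<in> K" "v \<in> K" "0 \<in> K"
proof -
  have "u \<noteq> 0" "v \<noteq> 0" using u v by auto
  moreover have "norming (1 *\<^sub>R a + 0 *\<^sub>R b) u" "norming (0 *\<^sub>R a + 1 *\<^sub>R b) v" using u v by auto
  ultimately show "u \<in> K" "v \<in> K"
    using kernel_iff zero_le_one order_refl by blast+
  then show "0 \<in> K" using residual_range_conic[OF closed_convex_cone_wedge, of a b u 0] by simp
qed

text \<open>The normals at the end points are \<open>a\<close> and \<open>b\<close>, so the span of all normals has dimension two only if it is
\<open>span {a, b}\<close>.\<close>

lemma coherent_arc_iff:
  "coherent_arc \<sigma> (meridian_arc \<sigma> u v) \<longleftrightarrow>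
    (\<forall>x\<in>meridian_arc \<sigma> u v. outward_normal \<sigma> x \<in> span {a, b})"
proof -
  let ?N = "outward_normal \<sigma> ` meridian_arc \<sigma> u v"
  have "s *\<^sub>R u + t *\<^sub>R v \<in> meridian_arc \<sigma> u v"
    if "0 \<le> s" "0 \<le> t" "\<sigma> (s *\<^sub>R u + t *\<^sub>R v) = 1" for s t
    using that by (auto simp: meridian_arc_def norm_sphere_def)
  from this[of 1 0] this[of 0 1] have "u \<in> meridian_arc \<sigma> u v" "v \<in> meridian_arc \<sigma> u v"
    using u v by simp_all
  moreover have "outward_normal \<sigma> u = a" "outward_normal \<sigma> v = b"
    using outward_normal_eq[OF u] outward_normal_eq[OF v] unit by simp_all
  ultimately have ab: "{a, b} \<subseteq> ?N" by force
  have "a \<notin> span {b}"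
  proof
    assume "a \<in> span {b}"
    then obtain c where "a = c *\<^sub>R b" by (auto simp: span_singleton)
    moreover from this have "\<bar>c\<bar> = 1" using unit by simp
    ultimately show False using distinct by (auto simp: abs_if split: if_splits)
  qed
  moreover have "b \<noteq> 0" using unit by auto
  ultimately have "independent {a, b}" using distinct by (simp add: independent_insert)
  then have dim: "dim {a, b} = 2" using distinct by (simp add: dim_eq_card_independent)
  have "dim ?N = 2 \<longleftrightarrow> ?N \<subseteq> span {a, b}"
  proof
    assume "dim ?N = 2"
    then have "span {a, b} = span ?N" using dim ab by (intro dim_eq_span) auto
    then show "?N \<subseteq> span {a, b}" using span_superset[of ?N] by simp
  next
    assume "?N \<subseteq> span {a, b}"
    then have "span ?N = span {a, b}" using ab
      by (intro subset_antisym span_mono span_minimal subspace_span)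
    then show "dim ?N = 2" using dim by (metis dim_span)
  qed
  then show ?thesis by (auto simp: coherent_arc_def)
qed

lemma coherent_if_convex_kernel:
  assumes "convex K"
  shows "coherent_arc \<sigma> (meridian_arc \<sigma> u v)"
  unfolding coherent_arc_iff
proof
  fix x assume "x \<in> meridian_arc \<sigma> u v"
  then obtain s t where x: "x = s *\<^sub>R u + t *\<^sub>R v" "0 \<le> s" "0 \<le> t" "\<sigma> x = 1"
    by (auto simp: meridian_arc_def norm_sphere_def)
  have "conic K" using residual_range_conic[OF closed_convex_cone_wedge] by (auto simp: conic_def)
  then have "convex_cone K" using assms rays_in_kernel by (auto simp: convex_cone_def)
  then have "x \<in> K" using rays_in_kernel x(2,3) unfolding x(1) convex_cone_iff by blast
  moreover have "x \<noteq> 0" using x by auto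
  ultimately obtain p q where "norming (p *\<^sub>R a + q *\<^sub>R b) x" using kernel_iff by blast
  moreover have "p *\<^sub>R a + q *\<^sub>R b \<in> span {a, b}"
    by (intro span_add span_scale span_base) auto
  ultimately show "outward_normal \<sigma> x \<in> span {a, b}"
    using x(4) by (simp add: outward_normal_eq span_scale)
qed

text \<open>Coherence puts the normal in \<open>span {a, b}\<close>; \<open>norming_pairing_signs\<close> makes its coefficients
nonnegative.\<close>

lemma arc_cone_in_kernel:
  assumes coh: "coherent_arc \<sigma> (meridian_arc \<sigma> u v)" and st: "0 \<le> s" "0 \<le> t"
  shows "s *\<^sub>R u + t *\<^sub>R v \<in> K"
proof -
  have conic: "r *\<^sub>R w \<in> K" if "w \<in> K" "0 \<le> r" for r w
    using that residual_range_conic[OF closed_convex_cone_wedge] by auto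
  define x where "x = s *\<^sub>R u + t *\<^sub>R v"
  consider "s = 0" | "t = 0" | "x = 0" | "0 < s" "0 < t" "x \<noteq> 0" using st by force
  then have "x \<in> K"
  proof cases
    case 4
    define y where "y = (1 / \<sigma> x) *\<^sub>R x"
    have \<sigma>x: "0 < \<sigma> x" using 4 by simp
    have y: "\<sigma> y = 1" "y \<noteq> 0" "y = (s / \<sigma> x) *\<^sub>R u + (t / \<sigma> x) *\<^sub>R v"
      using 4 by (auto simp: y_def scale) (simp add: x_def scaleR_add_right)
    then have "y \<in> meridian_arc \<sigma> u v"
      using st \<sigma>x unfolding meridian_arc_def norm_sphere_def by force
    then have "outward_normal \<sigma> y \<in> span {a, b}" using coh coherent_arc_iff by blast
    then obtain \<alpha> where "outward_normal \<sigma> y - \<alpha> *\<^sub>R a \<in> span {b}"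
      by (auto simp: span_breakdown_eq)
    then obtain \<beta> where "outward_normal \<sigma> y - \<alpha> *\<^sub>R a = \<beta> *\<^sub>R b"
      by (auto simp: span_singleton)
    then have n: "outward_normal \<sigma> y = \<alpha> *\<^sub>R a + \<beta> *\<^sub>R b"
      by (simp add: diff_eq_eq add.commute)
    obtain k where k: "norming k y" using ex_norming[OF y(2)] .
    then have "norming ((1 / norm k) *\<^sub>R k) y"
      by (subst norming_scale_left_iff) (auto simp: norming_def)
    then have n': "norming (\<alpha> *\<^sub>R a + \<beta> *\<^sub>R b) y"
      using outward_normal_eq[OF k y(1)] n by simp
    have "0 \<le> \<alpha> \<and> 0 \<le> \<beta>"
      using 4 \<sigma>x by (intro norming_pairing_signs(1)[OF u(1) v(1) n' u(2) v(2) y(1) cross_pairings y(3)])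
        (auto simp: inner_add_left)
    then have "y \<in> K" using kernel_iff[OF y(2)] n' by blast
    then have "\<sigma> x *\<^sub>R y \<in> K" using conic nonneg by blast
    then show ?thesis using 4 by (simp add: y_def)
  qed (use st rays_in_kernel conic in \<open>auto simp: x_def\<close>)
  then show ?thesis by (simp add: x_def)
qed

text \<open>For every functional \<open>k\<close> in the open cone of \<open>a\<close> and \<open>b\<close> some unit vector in the cone of \<open>u\<close> and \<open>v\<close>
has a normal \<open>h\<close> that is proportional to \<open>k\<close> on the plane of \<open>u\<close> and \<open>v\<close>.  Off the plane nothing is
claimed about \<open>h\<close>; that is where coherence enters later.\<close>

lemma ex_dual_point:
  assumes "0 < \<alpha>" "0 < \<beta>"
  obtains x s t h c where "\<sigma> x = 1" "x = s *\<^sub>R u + t *\<^sub>R v" "0 \<le> s" "0 \<le> t" "norming h x" "0 < c"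
    "h \<bullet> u = c * (\<alpha> * (a \<bullet> u) + \<beta> * (b \<bullet> u))" "h \<bullet> v = c * (\<alpha> * (a \<bullet> v) + \<beta> * (b \<bullet> v))"
proof -
  define k where "k = \<alpha> *\<^sub>R a + \<beta> *\<^sub>R b"
  have k: "k \<bullet> u = \<alpha> * (a \<bullet> u) + \<beta> * (b \<bullet> u)" "k \<bullet> v = \<alpha> * (a \<bullet> v) + \<beta> * (b \<bullet> v)"
    by (simp_all add: k_def inner_add_left)
  obtain e p q where e: "e = p *\<^sub>R u + q *\<^sub>R v" "0 < k \<bullet> e"
  proof -
    have "k \<bullet> u \<noteq> 0 \<or> k \<bullet> v \<noteq> 0"
      using coefficients_determined[of \<alpha> \<beta>] assms unfolding k by linarith
    then have "0 < k \<bullet> ((k \<bullet> u) *\<^sub>R u + (k \<bullet> v) *\<^sub>R v)"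
      by (simp add: inner_add_right sum_squares_gt_zero_iff)
    then show thesis by (rule that[OF refl])
  qed
  \<comment> \<open>\<open>d\<close> spans the kernel of \<open>k\<close> in the plane.  The residual of \<open>e\<close> after projection onto this line has
    a normal that vanishes on \<open>d\<close>, and is therefore proportional to \<open>k\<close> on the plane.\<close>
  define d where "d = (k \<bullet> v) *\<^sub>R u - (k \<bullet> u) *\<^sub>R v"
  have kd: "k \<bullet> d = 0" by (simp add: d_def inner_diff_right)
  have L: "closed (span {d})" "convex (span {d})" "span {d} \<noteq> {}" "0 \<in> span {d}"
    by (simp_all add: closed_span span_0 subspace_imp_convex) (use span_0 in blast)
  define z where "z = e - norm_proj \<sigma> (span {d}) e"
  obtain r where r: "norm_proj \<sigma> (span {d}) e = r *\<^sub>R d"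
    using norm_proj_in[OF L(1-3)] by (metis span_singleton rangeE)
  obtain p' q' where z: "z = p' *\<^sub>R u + q' *\<^sub>R v"
  proof -
    have "z = e - r *\<^sub>R d" by (simp only: z_def r)
    also have "\<dots> = (p - r * (k \<bullet> v)) *\<^sub>R u + (q + r * (k \<bullet> u)) *\<^sub>R v"
      by (simp add: e d_def algebra_simps)
    finally have "z = \<dots>" .
    then show thesis by (rule that)
  qed
  have kz: "0 < k \<bullet> z" using e(2) kd by (simp add: z_def r inner_diff_right)
  then have "z \<noteq> 0" by auto
  have "\<sigma> z \<le> \<sigma> (z - c)" if "c \<in> span {d}" for c
    using norm_proj_le[OF L(1-3), of "norm_proj \<sigma> (span {d}) e + c" e] norm_proj_in[OF L(1-3)] that
    by (simp add: z_def span_add diff_diff_eq)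
  then obtain h where h: "norming h z" "\<forall>c\<in>span {d}. h \<bullet> c \<le> 0"
    using best_approximation_iff[OF L(2,4) \<open>z \<noteq> 0\<close>] by blast
  have "d \<in> span {d}" "- d \<in> span {d}" by (auto intro: span_base span_neg)
  then have "h \<bullet> d \<le> 0" "h \<bullet> (- d) \<le> 0" using h(2) by blast+
  then have hd: "(k \<bullet> v) * (h \<bullet> u) = (k \<bullet> u) * (h \<bullet> v)" by (simp add: d_def inner_diff_right)
  have hz: "0 < h \<bullet> z" using norming_inner_pos[OF h(1) \<open>z \<noteq> 0\<close>] .
  define c where "c = (h \<bullet> z) / (k \<bullet> z)"
  have c: "0 < c" using hz kz by (simp add: c_def)
  have "(k \<bullet> z) * (h \<bullet> u) = p' * (k \<bullet> u) * (h \<bullet> u) + q' * ((k \<bullet> v) * (h \<bullet> u))"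
    "(k \<bullet> z) * (h \<bullet> v) = p' * ((k \<bullet> u) * (h \<bullet> v)) + q' * (k \<bullet> v) * (h \<bullet> v)"
    by (simp_all add: z inner_add_right algebra_simps)
  moreover have "(h \<bullet> z) * (k \<bullet> u) = p' * (k \<bullet> u) * (h \<bullet> u) + q' * ((k \<bullet> u) * (h \<bullet> v))"
    "(h \<bullet> z) * (k \<bullet> v) = p' * ((k \<bullet> v) * (h \<bullet> u)) + q' * (k \<bullet> v) * (h \<bullet> v)"
    by (simp_all add: z inner_add_right algebra_simps)
  ultimately have "(k \<bullet> z) * (h \<bullet> u) = (h \<bullet> z) * (k \<bullet> u)" "(k \<bullet> z) * (h \<bullet> v) = (h \<bullet> z) * (k \<bullet> v)"
    using hd by presburger+
  then have hk: "h \<bullet> u = c * (k \<bullet> u)" "h \<bullet> v = c * (k \<bullet> v)"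
    using kz by (auto simp: c_def field_simps)
  define s t where "s = p' / \<sigma> z" and "t = q' / \<sigma> z"
  define x where "x = (1 / \<sigma> z) *\<^sub>R z"
  have x: "\<sigma> x = 1" "norming h x"
    using \<open>z \<noteq> 0\<close> h(1) by (auto simp: x_def scale norming_scale_right_iff)
  have xs: "x = s *\<^sub>R u + t *\<^sub>R v" using z by (simp add: x_def s_def t_def scaleR_add_right)
  have hu: "h \<bullet> u = (c * \<alpha>) * (a \<bullet> u) + (c * \<beta>) * (b \<bullet> u)"
    and hv: "h \<bullet> v = (c * \<alpha>) * (a \<bullet> v) + (c * \<beta>) * (b \<bullet> v)"
    by (simp_all only: hk k distrib_left mult.assoc)
  have "0 \<le> s" "0 \<le> t"
    using norming_pairing_signs(2)[OF u(1) v(1) x(2) u(2) v(2) x(1) cross_pairings xs hu hv] assms c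
    by simp_all
  then show thesis
    by (rule that[OF x(1) xs _ _ x(2) c hk[unfolded k]])
qed

text \<open>The point supplied by \<open>ex_dual_point\<close> has, by coherence, the same normal direction as \<open>w\<close>, so strict
convexity identifies it with \<open>w\<close> up to scaling.\<close>

lemma kernel_in_arc_cone:
  assumes coh: "coherent_arc \<sigma> (meridian_arc \<sigma> u v)" and "w \<in> K"
  obtains s t where "w = s *\<^sub>R u + t *\<^sub>R v" "0 \<le> s" "0 \<le> t"
proof -
  have "\<exists>s\<ge>0. \<exists>t\<ge>0. w = s *\<^sub>R u + t *\<^sub>R v"
  proof (cases "w = 0")
    case False
    define y where "y = (1 / \<sigma> w) *\<^sub>R w"
    have \<sigma>w: "0 < \<sigma> w" and wy: "w = \<sigma> w *\<^sub>R y" and y: "\<sigma> y = 1"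
      using False by (auto simp: y_def scale)
    obtain \<alpha> \<beta> where k: "0 \<le> \<alpha>" "0 \<le> \<beta>" "norming (\<alpha> *\<^sub>R a + \<beta> *\<^sub>R b) w"
      using kernel_iff[OF False] \<open>w \<in> K\<close> by blast
    then have ky: "norming (\<alpha> *\<^sub>R a + \<beta> *\<^sub>R b) y"
      using \<sigma>w by (simp add: y_def norming_scale_right_iff)
    then have "\<alpha> \<noteq> 0 \<or> \<beta> \<noteq> 0" by (auto simp: norming_def)
    then consider "0 < \<alpha>" "\<beta> = 0" | "\<alpha> = 0" "0 < \<beta>" | "0 < \<alpha>" "0 < \<beta>" using k by force
    then have "\<exists>s\<ge>0. \<exists>t\<ge>0. y = s *\<^sub>R u + t *\<^sub>R v"
    proof cases
      case 1
      then have "y = u" using ky u y by (intro norming_point_unique) (auto simp: norming_scale_left_iff)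
      then show ?thesis by (intro exI[of _ 1] exI[of _ 0] conjI) auto
    next
      case 2
      then have "y = v" using ky v y by (intro norming_point_unique) (auto simp: norming_scale_left_iff)
      then show ?thesis by (intro exI[of _ 1] exI[of _ 0] conjI) auto
    next
      case 3
      obtain x s t h c where x: "\<sigma> x = 1" "x = s *\<^sub>R u + t *\<^sub>R v" "0 \<le> s" "0 \<le> t"
        and h: "norming h x" "0 < c"
          "h \<bullet> u = c * (\<alpha> * (a \<bullet> u) + \<beta> * (b \<bullet> u))" "h \<bullet> v = c * (\<alpha> * (a \<bullet> v) + \<beta> * (b \<bullet> v))"
        using ex_dual_point[OF 3] .
      have "x \<in> K" using arc_cone_in_kernel[OF coh x(3,4)] x(2) by simp
      moreover have "x \<noteq> 0" using x by auto
      ultimately obtain p q where pq: "norming (p *\<^sub>R a + q *\<^sub>R b) x" using kernel_iff by blast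
      define l where "l = (h \<bullet> x) / ((p *\<^sub>R a + q *\<^sub>R b) \<bullet> x)"
      have "h = l *\<^sub>R (p *\<^sub>R a + q *\<^sub>R b)"
        unfolding l_def by (rule norming_unique_direction[OF pq h(1) x(1)])
      then have hl: "h = (l * p) *\<^sub>R a + (l * q) *\<^sub>R b" by (simp add: scaleR_add_right)
      \<comment> \<open>\<open>h\<close> and \<open>c *\<^sub>R (\<alpha> *\<^sub>R a + \<beta> *\<^sub>R b)\<close> agree at \<open>u\<close> and \<open>v\<close>.\<close>
      have "l * p - c * \<alpha> = 0 \<and> l * q - c * \<beta> = 0"
        using h(3,4) by (intro coefficients_determined) (simp_all add: hl inner_add_left algebra_simps)
      then have "h = c *\<^sub>R (\<alpha> *\<^sub>R a + \<beta> *\<^sub>R b)" using hl by (simp add: scaleR_add_right)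
      then have "norming (\<alpha> *\<^sub>R a + \<beta> *\<^sub>R b) x" using h(1,2) norming_scale_left_iff by simp
      then have "y = x" using ky y x(1) by (intro norming_point_unique)
      then show ?thesis using x by blast
    qed
    then obtain s t where "0 \<le> s" "0 \<le> t" "y = s *\<^sub>R u + t *\<^sub>R v" by blast
    then have "w = (\<sigma> w * s) *\<^sub>R u + (\<sigma> w * t) *\<^sub>R v" "0 \<le> \<sigma> w * s" "0 \<le> \<sigma> w * t"
      using wy by (auto simp: scaleR_add_right) 
    then show ?thesis by blast
  qed (auto intro!: exI[of _ 0])
  then show thesis using that by blast
qed

lemma convex_kernel_iff_coherent: "convex K \<longleftrightarrow> coherent_arc \<sigma> (meridian_arc \<sigma> u v)"
proof
  assume coh: "coherent_arc \<sigma> (meridian_arc \<sigma> u v)"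
  have "K = {s *\<^sub>R u + t *\<^sub>R v | s t. 0 \<le> s \<and> 0 \<le> t}"
  proof (intro set_eqI iffI)
    fix w assume "w \<in> K"
    then show "w \<in> {s *\<^sub>R u + t *\<^sub>R v | s t. 0 \<le> s \<and> 0 \<le> t}"
      using kernel_in_arc_cone[OF coh] by blast
  next
    fix w assume "w \<in> {s *\<^sub>R u + t *\<^sub>R v | s t. 0 \<le> s \<and> 0 \<le> t}"
    then show "w \<in> K" using arc_cone_in_kernel[OF coh] by blast
  qed
  moreover have "convex {s *\<^sub>R u + t *\<^sub>R v | s t. 0 \<le> s \<and> 0 \<le> t}"
  proof (rule convexI; clarify)
    fix p q s t s' t' :: real
    assume "0 \<le> p" "0 \<le> q" "0 \<le> s" "0 \<le> t" "0 \<le> s'" "0 \<le> t'"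
    then show "\<exists>s'' t''. p *\<^sub>R (s *\<^sub>R u + t *\<^sub>R v) + q *\<^sub>R (s' *\<^sub>R u + t' *\<^sub>R v) = s'' *\<^sub>R u + t'' *\<^sub>R v \<and>
        0 \<le> s'' \<and> 0 \<le> t''"
      by (intro exI[of _ "p * s + q * s'"] exI[of _ "p * t + q * t'"]) (auto simp: algebra_simps)
  qed
  ultimately show "convex K" by metis
qed (rule coherent_if_convex_kernel)

end

section \<open>The three equivalent assertions\<close>

theorem theorem6:
  fixes \<sigma> :: "real ^ 'n \<Rightarrow> real"
    and a1 a2 :: "real ^ 'n"
    and \<omega> :: "(real ^ 'n) set"
    and P R :: "real ^ 'n \<Rightarrow> real ^ 'n"
  assumes "is_norm \<sigma>"
    and "strictly_convex_norm \<sigma>"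
    and "smooth_norm \<sigma>"
    and "norm a1 = 1"
    and "norm a2 = 1"
    and "hyperplane0 a1 \<noteq> hyperplane0 a2"
    and "\<omega> = halfspace0 a1 \<inter> halfspace0 a2"
    and "P = norm_proj \<sigma> \<omega>"
    and "R = (\<lambda>x. x - P x)"
  shows "(mutually_polar_retractions_on_convex_cones P R \<longleftrightarrow> convex_additive_on (range R) P) \<and>
    (convex_additive_on (range R) P \<longleftrightarrow>
      (\<forall>u v. u \<in> norm_ray \<sigma> (halfspace0 a1) \<and> \<sigma> u = 1 \<and>
             v \<in> norm_ray \<sigma> (halfspace0 a2) \<and> \<sigma> v = 1 \<longrightarrow>
             coherent_arc \<sigma> (meridian_arc \<sigma> u v)))"
proof -
  interpret strictly_convex_smooth_norm_space \<sigma>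
    using assms by unfold_locales
  have distinct: "a1 \<noteq> a2" "a1 \<noteq> - a2"
    using \<open>hyperplane0 a1 \<noteq> hyperplane0 a2\<close> by (auto simp: hyperplane0_def)
  have \<omega>: "closed \<omega>" "convex_cone \<omega>"
    using closed_convex_cone_wedge assms(7) by auto
  let ?K = "{w. norm_proj \<sigma> \<omega> w = 0}"
  have K_iff: "convex ?K \<longleftrightarrow> coherent_arc \<sigma> (meridian_arc \<sigma> u v)"
    if "norming a1 u" "\<sigma> u = 1" "norming a2 v" "\<sigma> v = 1" for u v
  proof -
    interpret wedge_rays \<sigma> a1 a2 u v
      using that distinct assms by unfold_locales
    show ?thesis using convex_kernel_iff_coherent assms(7) by simp
  qed
  have "a1 \<noteq> 0" "a2 \<noteq> 0" using assms by auto
  then obtain u v where "norming a1 u" "\<sigma> u = 1" "norming a2 v" "\<sigma> v = 1"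
    using ex_norming_point by metis
  then have "convex ?K \<longleftrightarrow>
      (\<forall>u v. u \<in> norm_ray \<sigma> (halfspace0 a1) \<and> \<sigma> u = 1 \<and>
             v \<in> norm_ray \<sigma> (halfspace0 a2) \<and> \<sigma> v = 1 \<longrightarrow>
             coherent_arc \<sigma> (meridian_arc \<sigma> u v))"
    using K_iff norm_ray_halfspace assms(4,5) by blast
  moreover have "mutually_polar_retractions_on_convex_cones P R \<longleftrightarrow> convex ?K"
    using mutually_polar_iff_convex_kernel[OF \<omega>] assms(8,9) by simp
  moreover have "convex_additive_on (range R) P \<longleftrightarrow> convex ?K"
    using convex_additive_iff_convex_kernel residual_range[OF \<omega>] assms(8,9) by simp
  ultimately show ?thesis by blast
qed

end
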